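(* Let $G$ be a graph with an odd number $n\geq 13$ of vertices. Then $\mathrm{mp}(G)=2n-5$ if and only if $G$ satisfies one of the following conditions: (1) $\delta(G)=n-2$ and $G\neq K_n-e$ for every edge $e$ of $K_n$; (2) $G=K_n-E(P_3)$, i.e., $G$ is obtained from $K_n$ by deleting the two edges of a path on three vertices.
   Context: All graphs are finite, simple and undirected; $\delta(G)$ is the minimum degree, $K_n$ the complete graph on $n$ vertices, $P_3$ a path with three vertices. A perfect matching is a set of edges covering every vertex exactly once; an almost-perfect matching is a set of edges covering every vertex except one exactly once and missing the remaining vertex. The matching preclusion number $\mathrm{mp}(G)$ is the minimum number of edges whose deletion leaves a graph with neither a perfect matching nor an almost-perfect matching ($\mathrm{mp}(G)=0$ if $G$ has neither). *)

theory Defs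
  imports "HOL-Library.Ramsey"
begin

definition complete_edges :: "'a set \<Rightarrow> 'a set set" where
  "complete_edges V = nsets V 2"

text \<open>A graph is given by its vertex set \<open>V\<close> and its set \<open>E\<close> of edges, which are
  two-element subsets of \<open>V\<close>.\<close>

definition finite_simple_graph :: "'a set \<Rightarrow> 'a set set \<Rightarrow> bool" where
  "finite_simple_graph V E \<longleftrightarrow> finite V \<and> E \<subseteq> complete_edges V"

definition degree :: "'a set set \<Rightarrow> 'a \<Rightarrow> nat" where
  "degree E v = card {e \<in> E. v \<in> e}"

text \<open>Meaningful only for a finite nonempty vertex set.\<close>

definition min_degree :: "'a set \<Rightarrow> 'a set set \<Rightarrow> nat" where
  "min_degree V E = Min (degree E ` V)"

definition perfect_matching :: "'a set \<Rightarrow> 'a set set \<Rightarrow> 'a set set \<Rightarrow> bool" where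
  "perfect_matching V E M \<longleftrightarrow> M \<subseteq> E \<and> (\<forall>v\<in>V. \<exists>!e. e \<in> M \<and> v \<in> e)"

definition almost_perfect_matching :: "'a set \<Rightarrow> 'a set set \<Rightarrow> 'a set set \<Rightarrow> bool" where
  "almost_perfect_matching V E M \<longleftrightarrow>
     M \<subseteq> E \<and> (\<exists>w\<in>V. (\<forall>v\<in>V - {w}. \<exists>!e. e \<in> M \<and> v \<in> e) \<and> (\<forall>e\<in>M. w \<notin> e))"

text \<open>A set of edges whose deletion leaves neither a perfect nor an almost-perfect matching.\<close>

definition matching_preclusion_set :: "'a set \<Rightarrow> 'a set set \<Rightarrow> 'a set set \<Rightarrow> bool" where
  "matching_preclusion_set V E F \<longleftrightarrow>
     F \<subseteq> E \<and>
     (\<nexists>M. perfect_matching V (E - F) M) \<and>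
     (\<nexists>M. almost_perfect_matching V (E - F) M)"

text \<open>If \<open>G\<close> has neither kind of matching, the empty set is a preclusion set and the value is 0,
  so that convention needs no separate case. A preclusion set exists exactly when \<open>V\<close> has at
  least two vertices (delete all edges); for smaller \<open>V\<close> the value is unspecified.\<close>

definition mp :: "'a set \<Rightarrow> 'a set set \<Rightarrow> nat" where
  "mp V E = (LEAST k. \<exists>F. matching_preclusion_set V E F \<and> card F = k)"

text \<open>As complete graphs are determined by their vertex set, \<open>G = K\<^sub>n - e\<close> and
  \<open>G = K\<^sub>n - E(P\<^sub>3)\<close> are expressed by deletion from the complete graph on \<open>V(G)\<close> itself; this
  is the same as isomorphism to such a graph.\<close>

definition is_complete_minus_edge :: "'a set \<Rightarrow> 'a set set \<Rightarrow> bool" where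
  "is_complete_minus_edge V E \<longleftrightarrow> (\<exists>e\<in>complete_edges V. E = complete_edges V - {e})"

definition is_complete_minus_P3 :: "'a set \<Rightarrow> 'a set set \<Rightarrow> bool" where
  "is_complete_minus_P3 V E \<longleftrightarrow>
     (\<exists>x\<in>V. \<exists>y\<in>V. \<exists>z\<in>V. x \<noteq> y \<and> y \<noteq> z \<and> x \<noteq> z \<and>
        E = complete_edges V - {{x, y}, {y, z}})"

end

theory Submission
  imports Defs "HOL-Library.Disjoint_Sets"
begin

text \<open>
  Work in the complement: the nonedges of \<open>G\<close> together with a preclusion set are the nonedges of a
  graph without almost-perfect matching. Write \<open>n = 2m + 3\<close>. Shrinking the set of nonedges to a
  minimal one gives a matching \<open>M\<close> of size \<open>m\<close> that misses three vertices \<open>u, v, w\<close>. Let \<open>B\<close>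
  consist of the partners of the vertices adjacent to all of \<open>u, v, w\<close>, and \<open>U = {u, v, w} \<union> B\<close>, with
  \<open>k = 3 + t\<close> elements. Any two vertices of \<open>U\<close> can be made simultaneously unmatched by exchanging edges
  of \<open>M\<close> that meet \<open>B\<close>. Since no augmentation is possible, \<open>U\<close> is independent and each of the
  remaining \<open>m - t\<close> edges of \<open>M\<close> has at least \<open>k + 1\<close> nonedges to \<open>U\<close>. Hence there are at least
  \<open>(k choose 2) + (k + 1)(m - t) \<ge> 2n - 3\<close> nonedges. If the nonedges of \<open>G\<close> form a matching, at most \<open>k\<close>
  of the counted ones are nonedges of \<open>G\<close>, which leaves \<open>2n - 5\<close>, except that the case \<open>t = 0\<close>
  falls short by one and equality has to be excluded there. Conversely, isolating two vertices
  \<open>p, q\<close> shows that \<open>mp(G)\<close> is at most \<open>2n - 3\<close> minus the number of nonedges of \<open>G\<close> at \<open>p\<close> or \<open>q\<close>.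
\<close>

section \<open>Augmentation and exchange for matchings that miss three vertices\<close>

lemma disjoint_insertI: "disjoint M \<Longrightarrow> e \<inter> \<Union>M = {} \<Longrightarrow> disjoint (insert e M)"
  by (auto simp: pairwise_insert disjnt_def)

text \<open>Matchings are disjoint families of edges with a prescribed union, so exchanging edges
  becomes set algebra.\<close>

locale matching_deficient_graph =
  fixes V :: "'a set" and E :: "'a set set"
  assumes finite_V: "finite V"
    and edges: "E \<subseteq> nsets V 2"
    and no_almost_perfect: "\<lbrakk>M \<subseteq> E; disjoint M; z \<in> V\<rbrakk> \<Longrightarrow> \<Union>M \<noteq> V - {z}"
begin

definition triple_matching :: "'a set set \<Rightarrow> 'a \<Rightarrow> 'a \<Rightarrow> 'a \<Rightarrow> bool" where
  "triple_matching M u v w \<longleftrightarrow>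
     M \<subseteq> E \<and> disjoint M \<and> \<Union>M = V - {u, v, w} \<and> {u, v, w} \<subseteq> V \<and> u \<noteq> v \<and> u \<noteq> w \<and> v \<noteq> w"

lemma triple_matching_rotate:
  "triple_matching M u v w \<Longrightarrow> triple_matching M v w u"
  "triple_matching M u v w \<Longrightarrow> triple_matching M v u w"
  unfolding triple_matching_def by auto

lemma triple_matching_permute:
  assumes "triple_matching M u v w" "{x, y} \<subseteq> {u, v, w}" "x \<noteq> y"
  obtains z where "z \<in> {u, v, w}" "triple_matching M x y z" "triple_matching M z x y"
proof -
  have p: "triple_matching M u v w" "triple_matching M u w v" "triple_matching M v u w"
    "triple_matching M v w u" "triple_matching M w u v" "triple_matching M w v u"
    using assms(1) unfolding triple_matching_def by auto
  have "x = u \<and> y = v \<or> x = u \<and> y = w \<or> x = v \<and> y = u \<or> x = v \<and> y = w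
    \<or> x = w \<and> y = u \<or> x = w \<and> y = v"
    using assms(2,3) by auto
  then show ?thesis using p that by blast
qed

lemma triple_matching_nonadjacent:
  assumes "triple_matching M u v w"
  shows "{u, v} \<notin> E"
proof
  assume e: "{u, v} \<in> E"
  have M: "M \<subseteq> E" "disjoint M" "\<Union>M = V - {u, v, w}" "{u, v, w} \<subseteq> V" "u \<noteq> w" "v \<noteq> w"
    using assms unfolding triple_matching_def by auto
  have "insert {u, v} M \<subseteq> E" using e M by simp
  moreover have "disjoint (insert {u, v} M)"
    by (rule disjoint_insertI[OF M(2)]) (use M(3) in blast)
  moreover have "\<Union>(insert {u, v} M) = V - {w}" using M by auto
  ultimately show False using no_almost_perfect[of "insert {u, v} M" w] M(4) by simp
qed

lemma edge_noteq: "{x, y} \<in> E \<Longrightarrow> x \<noteq> y"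
  using edges doubleton_in_nsets_2 by (metis subsetD)

text \<open>Alternating along the path u, a, b moves the hole from \<open>u\<close> to
  \<open>b\<close> and keeps the other two holes.\<close>

lemma triple_matching_swap:
  assumes t: "triple_matching M u v w" and ab: "{a, b} \<in> M" and ua: "{u, a} \<in> E"
  shows "triple_matching (insert {u, a} (M - {{a, b}})) b v w"
proof -
  have M: "M \<subseteq> E" "disjoint M" "\<Union>M = V - {u, v, w}" "{u, v, w} \<subseteq> V" "u \<noteq> v" "u \<noteq> w" "v \<noteq> w"
    using t unfolding triple_matching_def by auto
  have neq: "a \<noteq> b" using ab M(1) edge_noteq by blast
  have ab': "a \<in> V - {u, v, w}" "b \<in> V - {u, v, w}" using ab M(3) by blast+
  have rest: "\<Union>(M - {{a, b}}) = V - {u, v, w, a, b}"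
  proof -
    have "\<Union>(M - {{a, b}}) = \<Union>M - {a, b}"
      using diff_Union_pairwise_disjoint[OF M(2), of "{{a,b}}"] ab by simp
    then show ?thesis unfolding M(3) by blast
  qed
  have "disjoint (M - {{a, b}})" using M(2) by (simp add: pairwise_subset)
  then have "disjoint (insert {u, a} (M - {{a, b}}))"
    by (rule disjoint_insertI) (use rest in blast)
  moreover have "\<Union>(insert {u, a} (M - {{a, b}})) = V - {b, v, w}"
    using rest neq ab' M(4-7) by auto
  ultimately show ?thesis
    unfolding triple_matching_def using M ua ab' by auto
qed

text \<open>Otherwise u, a, b, v would be an augmenting path: after the swap, \<open>b\<close> and
  \<open>v\<close> are both unmatched.\<close>

lemma triple_matching_no_augmentation:
  assumes t: "triple_matching M u v w" and ab: "{a, b} \<in> M" and ua: "{u, a} \<in> E"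
  shows "{b, v} \<notin> E"
  using triple_matching_nonadjacent[OF triple_matching_swap[OF assms]] .

end

section \<open>Vertices that can be left unmatched in pairs\<close>

locale matched_deficient_graph = matching_deficient_graph +
  fixes M :: "'a set set" and u v w :: 'a
  assumes triple: "triple_matching M u v w"
begin

text \<open>Adjacency of \<open>a\<close> to all three holes leaves a free choice of which hole is
  moved to \<open>b\<close>.\<close>

definition swappable :: "'a set" where
  "swappable = {b. \<exists>a. {a, b} \<in> M \<and> {u, a} \<in> E \<and> {v, a} \<in> E \<and> {w, a} \<in> E}"

definition outer :: "'a set" where
  "outer = {u, v, w} \<union> swappable"

text \<open>These edges survive every exchange made below, so they remain available for augmenting
  paths afterwards.\<close>

definition unswappable :: "'a set set" where
  "unswappable = {e \<in> M. e \<inter> swappable = {}}"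

lemma matching:
  "M \<subseteq> E" "disjoint M" "\<Union>M = V - {u, v, w}" "{u, v, w} \<subseteq> V" "u \<noteq> v" "u \<noteq> w" "v \<noteq> w"
  using triple unfolding triple_matching_def by auto

lemma matching_partner_unique:
  assumes "{a, b} \<in> M" "{c, b} \<in> M"
  shows "a = c"
proof -
  have "{a, b} = {c, b}"
    using disjointD[OF matching(2) assms] by auto
  then show ?thesis by (auto simp: doubleton_eq_iff)
qed

lemma matching_edgeE:
  assumes "e \<in> M"
  obtains a b where "e = {a, b}" "a \<noteq> b" "a \<in> V - {u, v, w}" "b \<in> V - {u, v, w}"
proof -
  obtain a b where "e = {a, b}" "a \<noteq> b"
    using assms matching(1) edges nsets2_E[of e V] by blast
  then show ?thesis using that[of a b] assms matching(3) by blast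
qed

lemma swappable_obtain:
  assumes "b \<in> swappable"
  obtains a where "{a, b} \<in> M" "{u, a} \<in> E" "{v, a} \<in> E" "{w, a} \<in> E"
  using assms unfolding swappable_def by blast

lemma swappable_subset: "swappable \<subseteq> V - {u, v, w}"
  using matching(3) unfolding swappable_def by blast

text \<open>The partner \<open>a\<close> of \<open>b\<close> sees every hole, in particular the
  third one \<open>z\<close>; filling \<open>z\<close> from \<open>a\<close> exposes
  \<open>b\<close> and leaves \<open>x\<close> and \<open>y\<close> exposed.\<close>

lemma swappable_unmatched:
  assumes "b \<in> swappable" "{x, y} \<subseteq> {u, v, w}" "x \<noteq> y"
  obtains M' where "triple_matching M' b x y" "unswappable \<subseteq> M'"
proof -
  obtain a where a: "{a, b} \<in> M" "{u, a} \<in> E" "{v, a} \<in> E" "{w, a} \<in> E"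
    using swappable_obtain[OF assms(1)] .
  obtain z where z: "z \<in> {u, v, w}" and t: "triple_matching M z x y"
    using triple_matching_permute[OF triple assms(2,3)] .
  have "{z, a} \<in> E" using z a by blast
  from triple_matching_swap[OF t a(1) this]
  have "triple_matching (insert {z, a} (M - {{a, b}})) b x y" .
  moreover have "unswappable \<subseteq> insert {z, a} (M - {{a, b}})"
    using assms(1) unfolding unswappable_def by auto
  ultimately show ?thesis using that by blast
qed

text \<open>At most two exchanges suffice. For two swappable vertices, the first fills
  \<open>u\<close> and the second fills \<open>v\<close>, while \<open>w\<close> stays
  exposed.\<close>

lemma outer_unmatched:
  assumes "x \<in> outer" "y \<in> outer" "x \<noteq> y"
  obtains M' z where "triple_matching M' x y z" "unswappable \<subseteq> M'"
proof -
  have s: "unswappable \<subseteq> M" unfolding unswappable_def by blast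
  consider "x \<in> {u, v, w}" "y \<in> {u, v, w}" | "x \<in> swappable" "y \<in> {u, v, w}"
    | "x \<in> {u, v, w}" "y \<in> swappable" | "x \<in> swappable" "y \<in> swappable"
    using assms unfolding outer_def by blast
  then show ?thesis
  proof cases
    case 1
    then obtain z where "triple_matching M x y z"
      using triple_matching_permute[OF triple _ assms(3)] by blast
    then show ?thesis using s that by blast
  next
    case 2
    then obtain z where "z \<in> {u, v, w}" "z \<noteq> y" using matching(5) by blast
    with 2 swappable_unmatched[of x y z] that show ?thesis by blast
  next
    case 3
    then obtain z where "z \<in> {u, v, w}" "z \<noteq> x" using matching(5) by blast
    with 3 swappable_unmatched[of y x z] that show ?thesis
      by (metis (no_types, lifting) empty_subsetI insert_subset triple_matching_rotate(2))
  next
    case 4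
    obtain a where a: "{a, x} \<in> M" "{u, a} \<in> E" "{v, a} \<in> E" "{w, a} \<in> E"
      using swappable_obtain[OF 4(1)] .
    obtain c where c: "{c, y} \<in> M" "{u, c} \<in> E" "{v, c} \<in> E" "{w, c} \<in> E"
      using swappable_obtain[OF 4(2)] .
    \<comment> \<open>The two exchanges use different edges of \<open>M\<close>: if they coincided,
      \<open>x\<close> would be adjacent to \<open>v\<close>, and u, a, x, v would be
      augmenting.\<close>
    have ne: "{c, y} \<noteq> {a, x}"
    proof
      assume "{c, y} = {a, x}"
      then have "c = x" using assms(3) by (auto simp: doubleton_eq_iff)
      then show False
        using triple_matching_no_augmentation[OF triple a(1,2)] c by (auto simp: insert_commute)
    qed
    let ?M = "insert {u, a} (M - {{a, x}})"
    have t1: "triple_matching ?M x v w" using triple_matching_swap[OF triple a(1,2)] .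
    have t2: "triple_matching ?M v x w" using triple_matching_rotate(2)[OF t1] .
    have "{c, y} \<in> ?M" using c ne by blast
    from triple_matching_swap[OF t2 this c(3)]
    have "triple_matching (insert {v, c} (?M - {{c, y}})) y x w" .
    then have "triple_matching (insert {v, c} (?M - {{c, y}})) x y w"
      by (rule triple_matching_rotate)
    moreover have "unswappable \<subseteq> insert {v, c} (?M - {{c, y}})"
      using 4 unfolding unswappable_def by blast
    ultimately show ?thesis using that by blast
  qed
qed

lemma outer_independent:
  assumes "x \<in> outer" "y \<in> outer"
  shows "{x, y} \<notin> E"
proof (cases "x = y")
  case True
  then show ?thesis using edge_noteq by blast
next
  case False
  then show ?thesis using outer_unmatched[OF assms] triple_matching_nonadjacent by metis
qed

text \<open>The edge \<open>{c, d}\<close> still belongs to a matching that exposes \<open>x\<close>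
  and \<open>y\<close>, so the path x, c, d, y would augment it.\<close>

lemma unswappable_no_augmentation:
  assumes "x \<in> outer" "y \<in> outer" "x \<noteq> y" "{c, d} \<in> unswappable" "{x, c} \<in> E"
  shows "{d, y} \<notin> E"
proof -
  obtain M' z where "triple_matching M' x y z" "unswappable \<subseteq> M'"
    using outer_unmatched[OF assms(1-3)] .
  then show ?thesis using triple_matching_no_augmentation assms(4,5) by blast
qed

lemma finite_M: "finite M"
  using matching(1) edges finite_V by (meson finite_imp_finite_nsets finite_subset)

lemma finite_outer: "finite outer" and outer_subset: "outer \<subseteq> V"
  using swappable_subset matching(4) finite_V finite_subset[of outer V]
  unfolding outer_def by auto

lemma card_outer: "card outer = card swappable + 3"
proof -
  have "finite swappable" using finite_outer unfolding outer_def by simp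
  moreover have "card {u, v, w} = 3" using matching by simp
  ultimately show ?thesis
    unfolding outer_def using swappable_subset by (subst card_Un_disjoint) auto
qed

text \<open>If both ends of an edge were swappable, \<open>a\<close> would be adjacent to
  \<open>u\<close> and \<open>b\<close> to \<open>v\<close>, making u, a, b, v augmenting.\<close>

lemma swappable_not_swappable:
  assumes "{a, b} \<in> M" "b \<in> swappable"
  shows "a \<notin> swappable"
proof
  assume a: "a \<in> swappable"
  obtain c where c: "{c, b} \<in> M" "{u, c} \<in> E" using swappable_obtain[OF assms(2)] by blast
  obtain d where d: "{d, a} \<in> M" "{v, d} \<in> E" using swappable_obtain[OF a] by blast
  have "c = a" "d = b" using matching_partner_unique c d assms(1) by (metis insert_commute)+
  then show False
    using triple_matching_no_augmentation[OF triple c] d by (simp add: insert_commute)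
qed

text \<open>Sending a swappable vertex to its matching edge is a bijection onto the edges that meet
  \<open>swappable\<close>; injectivity holds because no edge has two swappable ends.\<close>

lemma card_matching: "card M = card unswappable + card swappable"
proof -
  have "\<forall>b\<in>swappable. \<exists>e. e \<in> M \<and> b \<in> e" unfolding swappable_def by blast
  from bchoice[OF this] obtain f
    where f: "\<And>b. b \<in> swappable \<Longrightarrow> f b \<in> M \<and> b \<in> f b" by blast
  have "inj_on f swappable"
  proof (rule inj_onI)
    fix b c assume bc: "b \<in> swappable" "c \<in> swappable" "f b = f c"
    then obtain x y where "f b = {x, y}" using f matching_edgeE by metis
    with f bc swappable_not_swappable show "b = c"
      by (metis insert_commute insertE singletonD)
  qed
  moreover have "f ` swappable = M - unswappable"
  proof
    show "f ` swappable \<subseteq> M - unswappable" using f unfolding unswappable_def by blast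
    show "M - unswappable \<subseteq> f ` swappable"
    proof
      fix e assume "e \<in> M - unswappable"
      then obtain b where "b \<in> swappable" "b \<in> e" "e \<in> M" unfolding unswappable_def by blast
      then have "f b = e" using f disjointD[OF matching(2)] by blast
      then show "e \<in> f ` swappable" using \<open>b \<in> swappable\<close> by blast
    qed
  qed
  ultimately have "card swappable = card (M - unswappable)" by (metis card_image)
  moreover have "card (M - unswappable) = card M - card unswappable" "card unswappable \<le> card M"
    using finite_M by (auto simp: unswappable_def card_mono intro!: card_Diff_subset)
  ultimately show ?thesis by linarith
qed

section \<open>Counting the nonedges that meet \<open>outer\<close>\<close>

lemma card_V: "card V = 2 * card M + 3"
proof -
  have "card (\<Union>M) = (\<Sum>e\<in>M. card e)"
    by (rule card_Union_disjoint) (use matching(1,2) edges in \<open>auto simp: nsets_def\<close>)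
  also have "\<dots> = (\<Sum>e\<in>M. 2)"
    by (rule sum.cong) (use matching(1) edges in \<open>auto simp: nsets_def\<close>)
  finally have "card (V - {u, v, w}) = 2 * card M" by (simp add: matching(3))
  moreover have "card (V - {u, v, w}) = card V - card {u, v, w}"
    using matching(4) by (intro card_Diff_subset) auto
  moreover have "card {u, v, w} \<le> card V" using finite_V matching(4) by (rule card_mono)
  moreover have "card {u, v, w} = 3" using matching(5-7) by simp
  ultimately show ?thesis by linarith
qed

text \<open>Ordered pairs, with the outer vertex first, split by the end in \<open>e\<close> into
  products that are easy to count.\<close>

definition cross_at :: "'a set \<Rightarrow> ('a \<times> 'a) set" where
  "cross_at e = {(x, y) \<in> outer \<times> e. {x, y} \<notin> E}"

text \<open>With k outer vertices, at most k - 1 of the 2k pairs are edges. If both ends have outer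
  neighbours, these are one common vertex, giving 2 <= k - 1 edges. If only one end has any, it
  misses one of \<open>u\<close>, \<open>v\<close>, \<open>w\<close>, since otherwise the other end
  would be swappable.\<close>

lemma card_cross_at:
  assumes "e \<in> unswappable"
  shows "card (cross_at e) \<ge> card outer + 1"
proof -
  have eM: "e \<in> M" using assms unswappable_def by blast
  obtain c d where e: "e = {c, d}" "c \<noteq> d" using matching_edgeE[OF eM] .
  let ?N = "\<lambda>y. {x \<in> outer. {x, y} \<in> E}"
  have star: "card (?N y) < card outer" if y: "y \<in> {c, d}" for y
  proof -
    obtain y' where y': "e = {y, y'}" "y' \<in> e" using e y by blast
    have "y' \<notin> swappable" using assms y' unfolding unswappable_def by blast
    then have "\<not> {u, v, w} \<subseteq> ?N y" using eM y' unfolding swappable_def by blast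
    then have "?N y \<subset> outer" unfolding outer_def by blast
    then show ?thesis using finite_outer psubset_card_mono by blast
  qed
  have no: False if "x \<in> ?N c" "y \<in> ?N d" "x \<noteq> y" for x y
    using unswappable_no_augmentation[of x y c d] that assms e by (auto simp: insert_commute)
  have "card (?N c) + card (?N d) < card outer"
  proof -
    consider "?N c = {}" | "?N d = {}" | x y where "x \<in> ?N c" "y \<in> ?N d" by blast
    then show ?thesis
    proof cases
      case 1 then have "card (?N c) = 0" by (simp only: card.empty)
      then show ?thesis using star[of d] by simp
    next
      case 2 then have "card (?N d) = 0" by (simp only: card.empty)
      then show ?thesis using star[of c] by simp
    next
      case 3
      then have "?N c \<subseteq> {x}" "?N d \<subseteq> {x}" using no by blast+
      then have "card (?N c) \<le> 1" "card (?N d) \<le> 1"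
        using card_mono[of "{x}"] by fastforce+
      then show ?thesis using card_outer by linarith
    qed
  qed
  moreover have "card (cross_at e) = card (outer - ?N c) + card (outer - ?N d)"
  proof -
    have split: "cross_at e = (outer - ?N c) \<times> {c} \<union> (outer - ?N d) \<times> {d}"
      unfolding cross_at_def e by auto
    have "card ((outer - ?N c) \<times> {c} \<union> (outer - ?N d) \<times> {d})
        = card ((outer - ?N c) \<times> {c}) + card ((outer - ?N d) \<times> {d})"
      by (rule card_Un_disjoint) (use e(2) finite_outer in auto)
    then show ?thesis unfolding split by (simp add: card_cartesian_product)
  qed
  moreover have "card (outer - ?N c) = card outer - card (?N c)"
    "card (outer - ?N d) = card outer - card (?N d)"
    using finite_outer by (auto intro!: card_Diff_subset)
  ultimately show ?thesis by linarith
qed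

definition inner_nonedges :: "'a set set" where
  "inner_nonedges = nsets outer 2"

definition cross_nonedges :: "'a set set" where
  "cross_nonedges = (\<lambda>(x, y). {x, y}) ` (\<Union>e\<in>unswappable. cross_at e)"

lemma unswappable_outer_disjoint: "\<Union>unswappable \<inter> outer = {}"
  using matching(3) unfolding outer_def unswappable_def by blast

text \<open>Forgetting the order loses nothing: \<open>outer\<close> avoids the unswappable edges,
  so a pair reveals which end is outer.\<close>

lemma card_cross_nonedges: "card cross_nonedges = (\<Sum>e\<in>unswappable. card (cross_at e))"
proof -
  have "inj_on (\<lambda>(x, y). {x, y}) (\<Union>e\<in>unswappable. cross_at e)"
    using unswappable_outer_disjoint unfolding cross_at_def inj_on_def
    by (auto simp: doubleton_eq_iff)
  then have "card cross_nonedges = card (\<Union>e\<in>unswappable. cross_at e)"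
    unfolding cross_nonedges_def by (rule card_image)
  also have "\<dots> = (\<Sum>e\<in>unswappable. card (cross_at e))"
  proof (rule card_UN_disjoint)
    show "finite unswappable" using finite_M unfolding unswappable_def by simp
    have "finite e" if "e \<in> unswappable" for e
      using that matching_edgeE unfolding unswappable_def by (metis (mono_tags, lifting) finite.simps mem_Collect_eq)
    then show "\<forall>e\<in>unswappable. finite (cross_at e)"
      unfolding cross_at_def using finite_outer by (auto intro: finite_subset[of _ "outer \<times> _"])
    show "\<forall>i\<in>unswappable. \<forall>j\<in>unswappable. i \<noteq> j \<longrightarrow> cross_at i \<inter> cross_at j = {}"
      using matching(2) unfolding cross_at_def unswappable_def disjoint_def by blast
  qed
  finally show ?thesis .
qed

lemma card_inner_nonedges: "card inner_nonedges = card outer choose 2"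
proof -
  have "inner_nonedges = {B. B \<subseteq> outer \<and> card B = 2}"
    unfolding inner_nonedges_def nsets_def using finite_outer finite_subset by blast
  then show ?thesis using n_subsets[OF finite_outer] by simp
qed

lemma nonedges_subset: "inner_nonedges \<union> cross_nonedges \<subseteq> nsets V 2 - E"
proof -
  have "inner_nonedges \<subseteq> nsets V 2 - E"
    unfolding inner_nonedges_def using outer_independent outer_subset
    by (auto elim!: nsets2_E)
  moreover have "cross_nonedges \<subseteq> nsets V 2 - E"
  proof
    fix e assume "e \<in> cross_nonedges"
    then obtain x y where "e = {x, y}" "x \<in> outer" "y \<in> \<Union>unswappable" "{x, y} \<notin> E"
      unfolding cross_nonedges_def cross_at_def by auto
    moreover from this have "x \<noteq> y" using unswappable_outer_disjoint by blast
    moreover have "\<Union>unswappable \<subseteq> V" using matching(3) unfolding unswappable_def by blast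
    ultimately show "e \<in> nsets V 2 - E" using outer_subset by auto
  qed
  ultimately show ?thesis by blast
qed

lemma finite_nonedges: "finite inner_nonedges" "finite cross_nonedges"
  using nonedges_subset finite_imp_finite_nsets[OF finite_V]
  by (meson finite_Diff finite_subset le_sup_iff)+

lemma nonedges_disjoint: "inner_nonedges \<inter> cross_nonedges = {}"
  using unswappable_outer_disjoint
  unfolding inner_nonedges_def cross_nonedges_def cross_at_def by (auto simp: nsets_def)

lemma card_nonedges:
  "card (inner_nonedges \<union> cross_nonedges)
     \<ge> (card outer choose 2) + (card outer + 1) * card unswappable"
proof -
  have "(\<Sum>e\<in>unswappable. card outer + 1) \<le> card cross_nonedges"
    unfolding card_cross_nonedges using card_cross_at by (rule sum_mono)
  then have "(card outer + 1) * card unswappable \<le> card cross_nonedges" by (simp add: mult.commute)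
  then show ?thesis
    using card_Un_disjoint[OF finite_nonedges nonedges_disjoint] card_inner_nonedges by linarith
qed

end

section \<open>Numerical estimates\<close>

lemma two_times_choose_two: "2 * (n choose 2) = n * (n - 1)"
proof -
  have "even (n * (n - 1))" by (cases n) auto
  then show ?thesis by (simp add: choose_two)
qed

text \<open>Here \<open>s\<close> counts unswappable edges, \<open>t\<close> swappable vertices, and
  m = s + t. As n = 2m + 3, the right side is 2n - 3. After doubling, the claim reduces to t (t +
  2s) >= 3t.\<close>

lemma general_count:
  fixes s t :: nat
  assumes "s + t \<ge> 3"
  shows "((t + 3) choose 2) + (t + 3 + 1) * s \<ge> 4 * (s + t) + 3"
proof -
  have "2 * ((t + 3) choose 2) = t * t + 5 * t + 6"
    unfolding two_times_choose_two by (simp add: algebra_simps)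
  moreover have "3 * t \<le> t * t + 2 * (t * s)"
  proof -
    have "t * 3 \<le> t * (t + 2 * s)" using assms by (intro mult_left_mono) auto
    then show ?thesis by (simp add: algebra_simps)
  qed
  ultimately show ?thesis by (simp add: algebra_simps)
qed

text \<open>The right side is 2n - 5 plus an allowance of k = t + 3 for counted nonedges that were
  already nonedges of G. Doubling leaves t (t + 2s) >= 5t + 2; the bound 6t settles this only for t
  >= 2.\<close>

lemma mixed_count:
  fixes s t :: nat
  assumes "s + t \<ge> 5" "s \<ge> 1" "t \<ge> 1"
  shows "((t + 3) choose 2) + (t + 3 + 1) * s \<ge> 4 * (s + t) + 1 + (t + 3)"
proof -
  have "2 * ((t + 3) choose 2) = t * t + 5 * t + 6"
    unfolding two_times_choose_two by (simp add: algebra_simps)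
  moreover have "5 * t + 2 \<le> t * t + 2 * (t * s)"
  proof (cases "t = 1")
    case True
    then show ?thesis using assms by simp
  next
    case False
    have "t * 6 \<le> t * (t + 2 * s)" using assms by (intro mult_left_mono) auto
    then show ?thesis using False assms by (simp add: algebra_simps)
  qed
  ultimately show ?thesis by (simp add: algebra_simps)
qed

text \<open>The case s = 0, where \<open>h\<close> is the size of a matching inside k = t + 3
  vertices. The cruder allowance h <= t + 3 would fail at t = 5, where 28 < 29.\<close>

lemma independent_count:
  fixes t h :: nat
  assumes "t \<ge> 4" "2 * h \<le> t + 3"
  shows "(t + 3) choose 2 \<ge> 4 * t + 1 + h"
proof -
  have "2 * ((t + 3) choose 2) = t * t + 5 * t + 6"
    unfolding two_times_choose_two by (simp add: algebra_simps)
  moreover have "4 * t \<le> t * t" using assms by simp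
  ultimately show ?thesis using assms(2) by linarith
qed

text \<open>Choosing for each member of \<open>A\<close> a point of it in \<open>U\<close> is
  injective, because the members are disjoint.\<close>

lemma disjoint_touching_card:
  assumes "finite U" "disjoint H" "\<And>e. e \<in> A \<Longrightarrow> e \<in> H \<and> e \<inter> U \<noteq> {}"
  shows "card A \<le> card U"
proof -
  have "\<forall>e\<in>A. \<exists>x. x \<in> e \<inter> U" using assms(3) by blast
  from bchoice[OF this] obtain f where f: "\<And>e. e \<in> A \<Longrightarrow> f e \<in> e \<inter> U" by blast
  have "inj_on f A"
  proof (rule inj_onI)
    fix e e' assume e: "e \<in> A" "e' \<in> A" "f e = f e'"
    then have "f e \<in> e \<inter> e'" using f[of e] f[of e'] by simp
    then show "e = e'" using disjointD[OF assms(2), of e e'] assms(3) e by blast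
  qed
  moreover have "f ` A \<subseteq> U" using f by blast
  ultimately show ?thesis using assms(1) by (rule card_inj_on_le)
qed

section \<open>Lower bounds for the nonedges, also after discarding a matching
  \<open>H\<close>\<close>

context matched_deficient_graph
begin

abbreviation forced_nonedges :: "'a set set" where
  "forced_nonedges \<equiv> inner_nonedges \<union> cross_nonedges"

lemma finite_edges_total: "finite (nsets V 2)"
  using finite_imp_finite_nsets[OF finite_V] .

lemma card_nonedges_ge:
  assumes "card M \<ge> 3"
  shows "card (nsets V 2 - E) \<ge> 4 * card M + 3"
proof -
  have "card forced_nonedges \<le> card (nsets V 2 - E)"
    using nonedges_subset finite_edges_total by (intro card_mono) auto
  then show ?thesis
    using card_nonedges general_count[of "card unswappable" "card swappable"] assms
    unfolding card_outer card_matching by linarith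
qed

lemma cross_nonedge_obtain:
  assumes "e \<in> cross_nonedges"
  obtains x y where "e = {x, y}" "x \<in> outer" "y \<in> \<Union>unswappable" "{x, y} \<notin> E"
  using assms unfolding cross_nonedges_def cross_at_def by auto

lemma forced_nonedge_touches:
  assumes "e \<in> forced_nonedges"
  shows "e \<inter> outer \<noteq> {}"
  using assms
proof
  assume "e \<in> inner_nonedges"
  then show ?thesis unfolding inner_nonedges_def by (auto elim!: nsets2_E)
next
  assume "e \<in> cross_nonedges"
  then show ?thesis using cross_nonedge_obtain by blast
qed

text \<open>Later \<open>H\<close> is the set of nonedges of G, so that the nonedges outside
  \<open>H\<close> are edges deleted from G.\<close>

lemma card_nonedges_diff:
  "card (nsets V 2 - E - H) + card (forced_nonedges \<inter> H) \<ge> card forced_nonedges"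
proof -
  have "card (forced_nonedges - H) \<le> card (nsets V 2 - E - H)"
    using nonedges_subset finite_edges_total by (intro card_mono) auto
  moreover have "card forced_nonedges = card (forced_nonedges - H) + card (forced_nonedges \<inter> H)"
    using card_Int_Diff[of forced_nonedges H] finite_nonedges by simp
  ultimately show ?thesis by linarith
qed

lemma card_forced_Int_le:
  assumes "disjoint H"
  shows "card (forced_nonedges \<inter> H) \<le> card outer"
  using finite_outer assms
  by (rule disjoint_touching_card) (use forced_nonedge_touches in blast)

text \<open>Otherwise x, a, b, d, c, y would be an augmenting path for a matching that exposes
  \<open>x\<close> and \<open>y\<close>.\<close>

lemma matching_exchange_nonadjacent:
  assumes "{a, b} \<in> unswappable" "{c, d} \<in> unswappable" "{a, b} \<noteq> {c, d}"
    and "x \<in> outer" "y \<in> outer" "x \<noteq> y" "{x, a} \<in> E" "{y, c} \<in> E"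
  shows "{b, d} \<notin> E"
proof -
  obtain M' z where t: "triple_matching M' x y z" and s: "unswappable \<subseteq> M'"
    using outer_unmatched[OF assms(4-6)] .
  have "{a, b} \<in> M'" using s assms(1) by blast
  from triple_matching_rotate(2)[OF triple_matching_swap[OF t this assms(7)]]
  have t': "triple_matching (insert {x, a} (M' - {{a, b}})) y b z" .
  have "{c, d} \<in> insert {x, a} (M' - {{a, b}})" using s assms(2,3) by blast
  from triple_matching_no_augmentation[OF t' this assms(8)]
  show ?thesis by (simp add: insert_commute)
qed

text \<open>Of the six pairs exactly two are edges. Either they share their end in \<open>e\<close>,
  or they use both ends of \<open>e\<close> and then share the outer vertex by
  \<open>unswappable_no_augmentation\<close>.\<close>

lemma tight_edge_types [consumes 3, case_names triangle star]:
  assumes "e \<in> unswappable" "card outer = 3" "card (cross_at e) = 4"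
  obtains (triangle) c d x where "e = {c, d}" "c \<noteq> d" "x \<in> outer" "{x, c} \<in> E" "{x, d} \<in> E"
  | (star) c d x y where "e = {c, d}" "c \<noteq> d" "x \<in> outer" "y \<in> outer" "x \<noteq> y"
      "{x, c} \<in> E" "{y, c} \<in> E"
proof -
  have eM: "e \<in> M" using assms(1) unfolding unswappable_def by blast
  obtain c d where e: "e = {c, d}" "c \<noteq> d" using matching_edgeE[OF eM] .
  let ?Q = "{(x, y) \<in> outer \<times> e. {x, y} \<in> E}"
  have fin: "finite (outer \<times> e)" using finite_outer e by simp
  have "cross_at e = outer \<times> e - ?Q" "?Q \<subseteq> outer \<times> e" unfolding cross_at_def by auto
  then have "card (outer \<times> e) = card ?Q + card (cross_at e)"
    using fin card_mono[OF fin, of ?Q] by (simp add: card_Diff_subset finite_subset)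
  moreover have "card (outer \<times> e) = 6" using assms(2) e by (simp add: card_cartesian_product)
  ultimately have "card ?Q = 2" using assms(3) by linarith
  then obtain p q where pq: "?Q = {p, q}" "p \<noteq> q" by (auto simp: card_2_iff)
  obtain x1 y1 x2 y2 where xy: "p = (x1, y1)" "q = (x2, y2)" by (metis surj_pair)
  have "p \<in> ?Q" "q \<in> ?Q" unfolding pq(1) by auto
  then have Q: "x1 \<in> outer" "y1 \<in> e" "{x1, y1} \<in> E" "x2 \<in> outer" "y2 \<in> e" "{x2, y2} \<in> E"
    unfolding xy by auto
  show ?thesis
  proof (cases "y1 = y2")
    case True
    then have "x1 \<noteq> x2" using pq(2) xy by simp
    moreover obtain d' where "e = {y1, d'}" "y1 \<noteq> d'" using e Q(2) by blast
    ultimately show ?thesis using star Q True by blast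
  next
    case False
    then have e': "e = {y1, y2}" using e Q by auto
    have "x1 = x2"
    proof (rule ccontr)
      assume "x1 \<noteq> x2"
      from unswappable_no_augmentation[OF Q(1,4) this _ Q(3), of y2] Q(6) assms(1) e'
      show False by (simp add: insert_commute)
    qed
    then show ?thesis using triangle e' False Q by blast
  qed
qed

text \<open>This is the equality case t = 0. Augmenting paths through two matching edges force
  nonedges between matched vertices; all of these lie in the matching \<open>H\<close>, yet two of
  them share an end.\<close>

lemma no_tight_configuration:
  assumes sw: "unswappable = M" and c3: "card outer = 3" and "disjoint H" and "card M \<ge> 3"
    and tight: "\<And>e. e \<in> M \<Longrightarrow> card (cross_at e) = 4"
    and inH: "\<And>p q. p \<in> \<Union>M \<Longrightarrow> q \<in> \<Union>M \<Longrightarrow> p \<noteq> q \<Longrightarrow> {p, q} \<notin> E \<Longrightarrow> {p, q} \<in> H"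
    and miss: "\<And>x. x \<in> outer \<Longrightarrow> \<exists>y\<in>\<Union>M. {x, y} \<notin> E"
  shows False
proof -
  have H: "{b, d} \<in> H" if "{a, b} \<in> M" "{c, d} \<in> M" "{a, b} \<noteq> {c, d}"
    "x \<in> outer" "y \<in> outer" "x \<noteq> y" "{x, a} \<in> E" "{y, c} \<in> E" for a b c d x y
  proof (rule inH)
    show "b \<in> \<Union>M" "d \<in> \<Union>M" using that by auto
    show "b \<noteq> d" using disjointD[OF matching(2) that(1-3)] by auto
    show "{b, d} \<notin> E" using matching_exchange_nonadjacent that unfolding sw by blast
  qed
  have H1: "p = q" if "{r, p} \<in> H" "{r, q} \<in> H" for p q r
    using disjointD[OF assms(3) that] by (auto simp: doubleton_eq_iff)
  have no_triangle: False
    if e: "{c, d} \<in> M" "c \<noteq> d" "x \<in> outer" "{x, c} \<in> E" "{x, d} \<in> E" for c d x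
  proof -
    \<comment> \<open>The edge \<open>f\<close> contains a vertex not adjacent to \<open>x\<close>,
      so it differs from \<open>{c, d}\<close>, and if it is itself a triangle then its apex is not
      \<open>x\<close>.\<close>
    obtain y f where y: "{x, y} \<notin> E" "y \<in> f" "f \<in> M" using miss[OF e(3)] by blast
    have ne: "f \<noteq> {c, d}" using y e by blast
    have dc: "{d, c} \<in> M" using e(1) by (simp add: insert_commute)
    have "f \<in> unswappable" using y(3) sw by simp
    from this c3 tight[OF y(3)] show False
    proof (cases rule: tight_edge_types)
      case (triangle c' d' x')
      have "x \<noteq> x'" using triangle y by blast
      then have "{d, d'} \<in> H" "{d, c'} \<in> H"
        using H[of c d c' d' x x'] H[of c d d' c' x x'] e triangle y(3) ne
        by (simp_all add: insert_commute)
      then show False using H1 triangle(2) by blast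
    next
      case (star c' d' x1 x2)
      obtain x' where x': "x' \<in> outer" "x \<noteq> x'" "{x', c'} \<in> E" using star by metis
      have "{d, d'} \<in> H" "{c, d'} \<in> H"
        using H[of c d c' d' x x'] H[of d c c' d' x x'] e dc star(1) x' y(3) ne
        by (simp_all add: insert_commute)
      then show False using H1[of d' c d] e(2) by (simp add: insert_commute)
    qed
  qed
  have star: "\<exists>c d x y. e = {c, d} \<and> c \<noteq> d \<and> x \<in> outer \<and> y \<in> outer \<and> x \<noteq> y \<and>
      {x, c} \<in> E \<and> {y, c} \<in> E" if e: "e \<in> M" for e
  proof -
    have "e \<in> unswappable" using e sw by simp
    from this c3 tight[OF e] show ?thesis
    proof (cases rule: tight_edge_types)
      case (triangle c d x)
      then show ?thesis using no_triangle e by blast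
    next
      case (star c d x y)
      then show ?thesis by blast
    qed
  qed
  obtain T where "T \<subseteq> M" "card T = 3" using obtain_subset_with_card_n[OF assms(4)] by metis
  then obtain e1 e2 e3 where e: "e1 \<in> M" "e2 \<in> M" "e3 \<in> M" "e1 \<noteq> e2" "e1 \<noteq> e3" "e2 \<noteq> e3"
    by (auto simp: card_3_iff)
  obtain c1 d1 x1 y1 where 1: "e1 = {c1, d1}" "x1 \<in> outer" "y1 \<in> outer" "x1 \<noteq> y1"
      "{x1, c1} \<in> E" "{y1, c1} \<in> E" using star[OF e(1)] by blast
  obtain c2 d2 x2 y2 where 2: "e2 = {c2, d2}" "x2 \<in> outer" "y2 \<in> outer" "x2 \<noteq> y2"
      "{x2, c2} \<in> E" "{y2, c2} \<in> E" using star[OF e(2)] by blast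
  obtain c3 d3 x3 y3 where 3: "e3 = {c3, d3}" "x3 \<in> outer" "y3 \<in> outer" "x3 \<noteq> y3"
      "{x3, c3} \<in> E" "{y3, c3} \<in> E" using star[OF e(3)] by blast
  \<comment> \<open>Each star has two outer neighbours, so distinct ones can be chosen for the two
    edges. With the third edge, \<open>d1\<close> then lies in two members of
    \<open>H\<close>.\<close>
  have "{d1, d2} \<in> H"
  proof (cases "x1 = x2")
    case True
    then show ?thesis using H[of c1 d1 c2 d2 x1 y2] 1 2 e by simp
  next
    case False
    then show ?thesis using H[of c1 d1 c2 d2 x1 x2] 1 2 e by simp
  qed
  moreover have "{d1, d3} \<in> H"
  proof (cases "x1 = x3")
    case True
    then show ?thesis using H[of c1 d1 c3 d3 x1 y3] 1 3 e by simp
  next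
    case False
    then show ?thesis using H[of c1 d1 c3 d3 x1 x3] 1 3 e by simp
  qed
  ultimately have "d2 = d3" by (rule H1)
  then show False using disjointD[OF matching(2) e(2,3,6)] 2(1) 3(1) by auto
qed

text \<open>If \<open>x\<close> had no cross nonedge, every forced nonedge would meet
  \<open>outer - {x}\<close>, and the matching \<open>H\<close> could contain at most
  \<open>card outer - 1\<close> of them.\<close>

lemma unforced_miss:
  assumes "disjoint H" and card: "card (forced_nonedges \<inter> H) = card outer" and x: "x \<in> outer"
  shows "\<exists>y\<in>\<Union>unswappable. {x, y} \<notin> E"
proof (rule ccontr)
  assume no: "\<not> ?thesis"
  have "card (forced_nonedges \<inter> H) \<le> card (outer - {x})"
  proof (rule disjoint_touching_card[OF _ assms(1)])
    show "finite (outer - {x})" using finite_outer by simp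
    fix e assume e: "e \<in> forced_nonedges \<inter> H"
    have "e \<inter> (outer - {x}) \<noteq> {}"
    proof (cases "e \<in> inner_nonedges")
      case True
      then show ?thesis unfolding inner_nonedges_def by (auto elim!: nsets2_E)
    next
      case False
      then have "e \<in> cross_nonedges" using e by blast
      then obtain x' y where "e = {x', y}" "x' \<in> outer" "y \<in> \<Union>unswappable" "{x', y} \<notin> E"
        by (rule cross_nonedge_obtain)
      then show ?thesis using no by blast
    qed
    then show "e \<in> H \<and> e \<inter> (outer - {x}) \<noteq> {}" using e by blast
  qed
  moreover have "card (outer - {x}) < card outer" using x finite_outer by (rule card_Diff1_less[rotated])
  ultimately show False using card by linarith
qed

text \<open>The count 3 + 4m - 3 = 4m falls one short. A counterexample makes every estimate tight,
  which \<open>no_tight_configuration\<close> excludes.\<close>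

lemma card_nonedges_diff_matching_no_swappable:
  assumes "disjoint H" "card M \<ge> 3" and none: "swappable = {}"
  shows "card (nsets V 2 - E - H) \<ge> 4 * card M + 1"
proof (rule ccontr)
  assume small: "\<not> ?thesis"
  have c3: "card outer = 3" using card_outer none by simp
  have sw: "unswappable = M" unfolding unswappable_def none by blast
  have ge: "\<And>e. e \<in> M \<Longrightarrow> 4 \<le> card (cross_at e)"
    using card_cross_at sw c3 by fastforce
  have inner: "card inner_nonedges = 3" unfolding card_inner_nonedges c3 by (simp add: choose_two)
  have cross: "card cross_nonedges = (\<Sum>e\<in>M. card (cross_at e))"
    using card_cross_nonedges sw by simp
  have forced: "card forced_nonedges = 3 + card cross_nonedges"
    using card_Un_disjoint[OF finite_nonedges nonedges_disjoint] inner by simp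
  have lower: "4 * card M \<le> card cross_nonedges"
  proof -
    have "(\<Sum>e\<in>M. 4) \<le> (\<Sum>e\<in>M. card (cross_at e))" by (rule sum_mono) (rule ge)
    then show ?thesis unfolding cross by simp
  qed
  have diff: "card forced_nonedges \<le> card (nsets V 2 - E - H) + card (forced_nonedges \<inter> H)"
    using card_nonedges_diff .
  have "card (forced_nonedges \<inter> H) \<le> 3" using card_forced_Int_le[OF assms(1)] c3 by simp
  with small diff forced lower
  have eq: "card cross_nonedges = 4 * card M" "card (forced_nonedges \<inter> H) = 3"
    "card (nsets V 2 - E - H) = 4 * card M"
    by linarith+
  have tight: "card (cross_at e) = 4" if "e \<in> M" for e
  proof (rule ccontr)
    assume "card (cross_at e) \<noteq> 4"
    then have "4 < card (cross_at e)" using ge[OF that] by linarith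
    then have "(\<Sum>e\<in>M. 4) < (\<Sum>e\<in>M. card (cross_at e))"
      using finite_M ge that by (intro sum_strict_mono_ex1) auto
    then show False using cross eq(1) by simp
  qed
  \<comment> \<open>By equal cardinality every nonedge outside \<open>H\<close> is forced and so
    meets \<open>outer\<close>; hence nonedges between matched vertices lie in
    \<open>H\<close>.\<close>
  have "forced_nonedges - H = nsets V 2 - E - H"
  proof (rule card_subset_eq)
    show "finite (nsets V 2 - E - H)" using finite_edges_total by simp
    show "forced_nonedges - H \<subseteq> nsets V 2 - E - H" using nonedges_subset by blast
    show "card (forced_nonedges - H) = card (nsets V 2 - E - H)"
      using card_Int_Diff[of forced_nonedges H] finite_nonedges eq forced by simp
  qed
  then have inH: "{p, q} \<in> H" if "p \<in> \<Union>M" "q \<in> \<Union>M" "p \<noteq> q" "{p, q} \<notin> E" for p q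
  proof -
    have "p \<notin> outer" "q \<notin> outer" using that(1,2) unswappable_outer_disjoint sw by blast+
    then have "{p, q} \<notin> forced_nonedges" using forced_nonedge_touches[of "{p, q}"] by blast
    moreover have "{p, q} \<in> nsets V 2" using that matching(3) by auto
    ultimately show ?thesis using that(4) \<open>forced_nonedges - H = nsets V 2 - E - H\<close> by blast
  qed
  have miss: "\<exists>y\<in>\<Union>M. {x, y} \<notin> E" if "x \<in> outer" for x
    using unforced_miss[OF assms(1) _ that] eq(2) c3 sw by simp
  show False
    using no_tight_configuration[OF sw c3 assms(1,2) tight inH miss] by blast
qed

lemma card_nonedges_diff_matching:
  assumes H: "disjoint H" "H \<subseteq> nsets V 2" and m: "card M \<ge> 5"
  shows "card (nsets V 2 - E - H) \<ge> 4 * card M + 1"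
proof -
  let ?s = "card unswappable" and ?t = "card swappable"
  have st: "card M = ?s + ?t" by (rule card_matching)
  have fin: "finite swappable" using finite_outer unfolding outer_def by simp
  have diff: "card forced_nonedges \<le> card (nsets V 2 - E - H) + card (forced_nonedges \<inter> H)"
    using card_nonedges_diff .
  have forced: "((?t + 3) choose 2) + (?t + 3 + 1) * ?s \<le> card forced_nonedges"
    using card_nonedges unfolding card_outer .
  consider "?t = 0" | "?t \<ge> 1" "?s \<ge> 1" | "?s = 0" by linarith
  then show ?thesis
  proof cases
    case 1
    then show ?thesis using card_nonedges_diff_matching_no_swappable[OF H(1)] m fin by simp
  next
    case 2
    have "5 \<le> ?s + ?t" using m st by simp
    from order_trans[OF mixed_count[OF this 2(2,1)] forced]
    have "4 * card M + 1 + (?t + 3) \<le> card forced_nonedges" unfolding st .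
    moreover have "card (forced_nonedges \<inter> H) \<le> ?t + 3"
      using card_forced_Int_le[OF H(1)] unfolding card_outer .
    ultimately show ?thesis using diff by linarith
  next
    case 3
    have "finite unswappable" using finite_M unfolding unswappable_def by simp
    then have "cross_nonedges = {}" using 3 unfolding cross_nonedges_def by simp
    then have sub: "forced_nonedges \<inter> H \<subseteq> nsets outer 2" unfolding inner_nonedges_def by blast
    \<comment> \<open>Only inner nonedges are left, so each counted member of \<open>H\<close> uses
      two outer vertices.\<close>
    have "card (\<Union>(forced_nonedges \<inter> H)) = (\<Sum>e\<in>forced_nonedges \<inter> H. card e)"
    proof (rule card_Union_disjoint)
      show "disjoint (forced_nonedges \<inter> H)" using H(1) by (rule pairwise_subset) blast
      show "\<And>e. e \<in> forced_nonedges \<inter> H \<Longrightarrow> finite e" using H(2) by (auto simp: nsets_def)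
    qed
    also have "\<dots> = (\<Sum>e\<in>forced_nonedges \<inter> H. 2)"
      by (rule sum.cong) (use H(2) in \<open>auto simp: nsets_def\<close>)
    finally have "2 * card (forced_nonedges \<inter> H) = card (\<Union>(forced_nonedges \<inter> H))" by simp
    also have "\<dots> \<le> card outer"
      using sub finite_outer by (intro card_mono) (auto simp: nsets_def)
    finally have "2 * card (forced_nonedges \<inter> H) \<le> ?t + 3" unfolding card_outer .
    then have "(?t + 3) choose 2 \<ge> 4 * ?t + 1 + card (forced_nonedges \<inter> H)"
      by (intro independent_count) (use m st 3 in auto)
    then show ?thesis using diff forced st 3 by simp
  qed
qed

end

section \<open>From preclusion sets to matchings missing three vertices\<close>

lemma perfect_pairing_exists:
  assumes "finite W" "even (card W)"
  shows "\<exists>M \<subseteq> nsets W 2. disjoint M \<and> \<Union>M = W"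
  using assms
proof (induction "card W" arbitrary: W rule: less_induct)
  case less
  show ?case
  proof (cases "W = {}")
    case True
    then show ?thesis by auto
  next
    case False
    then have "card W \<noteq> 0" "card W \<noteq> 1" using less.prems by auto
    then have "card W \<ge> 2" by linarith
    from obtain_subset_with_card_n[OF this] obtain T where "T \<subseteq> W" "card T = 2" by metis
    then obtain p q where pq: "p \<in> W" "q \<in> W" "p \<noteq> q" by (auto simp: card_2_iff)
    have c: "card (W - {p, q}) = card W - 2"
      using pq card_Diff_subset[of "{p, q}" W] by simp
    then have "card (W - {p, q}) < card W" "even (card (W - {p, q}))"
      using \<open>card W \<ge> 2\<close> less.prems(2) by auto
    then obtain M where M: "M \<subseteq> nsets (W - {p, q}) 2" "disjoint M" "\<Union>M = W - {p, q}"
      using less.hyps less.prems(1) by (metis finite_Diff)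
    have "M \<subseteq> nsets W 2" using M(1) nsets_mono[of "W - {p, q}" W 2] by blast
    then have "insert {p, q} M \<subseteq> nsets W 2" using pq by simp
    moreover have "disjoint (insert {p, q} M)"
      by (rule disjoint_insertI[OF M(2)]) (use M(3) in blast)
    moreover have "\<Union>(insert {p, q} M) = W" using M(3) pq by auto
    ultimately show ?thesis by blast
  qed
qed

definition near_perfect :: "'a set \<Rightarrow> 'a set set \<Rightarrow> bool" where
  "near_perfect V E \<longleftrightarrow> (\<exists>M \<subseteq> E. disjoint M \<and> (\<exists>z\<in>V. \<Union>M = V - {z}))"

lemma near_perfect_complete:
  assumes "finite V" "odd (card V)"
  shows "near_perfect V (nsets V 2)"
proof -
  obtain z where z: "z \<in> V" using assms by (metis card.empty ex_in_conv even_zero)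
  have "even (card (V - {z}))" using assms z by simp
  then obtain M where "M \<subseteq> nsets (V - {z}) 2" "disjoint M" "\<Union>M = V - {z}"
    using perfect_pairing_exists[of "V - {z}"] assms(1) by auto
  then show ?thesis
    unfolding near_perfect_def using z nsets_mono[of "V - {z}" V 2] by blast
qed

text \<open>Used in contrapositive form: what a preclusion set leaves over is not
  \<open>near_perfect\<close>.\<close>

lemma near_perfect_imp_almost_perfect:
  assumes "near_perfect V E"
  shows "\<exists>M. almost_perfect_matching V E M"
proof -
  obtain M z where M: "M \<subseteq> E" "disjoint M" "z \<in> V" "\<Union>M = V - {z}"
    using assms unfolding near_perfect_def by blast
  have "\<exists>!e. e \<in> M \<and> v \<in> e" if "v \<in> V - {z}" for v
  proof -
    have "v \<in> \<Union>M" using that unfolding M(4) .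
    then obtain e where "v \<in> e" "e \<in> M" by (rule UnionE)
    then show ?thesis using disjointD[OF M(2)] by (intro ex1I[of _ e]) auto
  qed
  then have "\<forall>v\<in>V - {z}. \<exists>!e. e \<in> M \<and> v \<in> e" by (intro ballI)
  moreover have "z \<notin> \<Union>M" unfolding M(4) by simp
  then have "\<forall>e\<in>M. z \<notin> e" by simp
  ultimately have "almost_perfect_matching V E M"
    unfolding almost_perfect_matching_def using M(1) by (intro conjI bexI[OF _ M(3)])
  then show ?thesis ..
qed

text \<open>A minimal set of nonedges yields a matching missing exactly three vertices: restoring any
  single nonedge \<open>e\<close> creates an almost-perfect matching, which must use \<open>e\<close>.\<close>

lemma matched_deficient_graph_exists:
  assumes V: "finite V" "odd (card V)" and N: "N \<subseteq> nsets V 2"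
    and deficient: "\<not> near_perfect V (nsets V 2 - N)"
  obtains N' M u v w where "N' \<subseteq> N" "matched_deficient_graph V (nsets V 2 - N') M u v w"
proof -
  let ?P = "\<lambda>N'. N' \<subseteq> N \<and> \<not> near_perfect V (nsets V 2 - N')"
  have "?P N" using deficient by simp
  from ex_has_least_nat[of ?P N card, OF this]
  obtain N' where N': "N' \<subseteq> N" "\<not> near_perfect V (nsets V 2 - N')"
    and least: "\<And>N''. ?P N'' \<Longrightarrow> card N' \<le> card N''" by blast
  have fin: "finite N'"
    using N N'(1) finite_imp_finite_nsets[OF V(1)] by (meson finite_subset)
  \<comment> \<open>A complete graph of odd order has an almost-perfect matching, so there is a
    nonedge to restore.\<close>
  have "N' \<noteq> {}" using N'(2) near_perfect_complete[OF V] by auto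
  then obtain e where e: "e \<in> N'" by blast
  have "card (N' - {e}) < card N'" using e fin by (rule card_Diff1_less[rotated])
  then have "near_perfect V (nsets V 2 - (N' - {e}))"
    using least[of "N' - {e}"] N'(1) by fastforce
  then obtain M0 z where M0: "M0 \<subseteq> nsets V 2 - (N' - {e})" "disjoint M0" "z \<in> V" "\<Union>M0 = V - {z}"
    unfolding near_perfect_def by blast
  have eM0: "e \<in> M0"
  proof (rule ccontr)
    assume "e \<notin> M0"
    then have "M0 \<subseteq> nsets V 2 - N'" using M0(1) by blast
    then show False using N'(2) M0(2-4) unfolding near_perfect_def by blast
  qed
  have "e \<in> nsets V 2" using e N'(1) N by blast
  then obtain p q where pq: "e = {p, q}" "p \<in> V" "q \<in> V" "p \<noteq> q" by (rule nsets2_E)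
  have "z \<notin> \<Union>M0" unfolding M0(4) by simp
  then have pz: "p \<noteq> z" "q \<noteq> z" using eM0 pq(1) by auto
  interpret matching_deficient_graph V "nsets V 2 - N'"
  proof
    show "finite V" by fact
    show "nsets V 2 - N' \<subseteq> nsets V 2" by blast
    show "\<Union>M \<noteq> V - {z}" if "M \<subseteq> nsets V 2 - N'" "disjoint M" "z \<in> V" for M z
      using N'(2) that unfolding near_perfect_def by blast
  qed
  have "\<Union>(M0 - {e}) = \<Union>M0 - e"
    using diff_Union_pairwise_disjoint[OF M0(2), of "{e}"] eM0 by simp
  then have "\<Union>(M0 - {e}) = V - {p, q, z}" unfolding M0(4) pq(1) by blast
  moreover have "disjoint (M0 - {e})" using M0(2) by (rule pairwise_subset) blast
  moreover have "M0 - {e} \<subseteq> nsets V 2 - N'" using M0(1) by blast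
  ultimately have "triple_matching (M0 - {e}) p q z"
    unfolding triple_matching_def using pq M0(3) pz by auto
  then have "matched_deficient_graph V (nsets V 2 - N') (M0 - {e}) p q z"
    by unfold_locales
  then show ?thesis using that N'(1) by blast
qed

lemma deficient_nonedges_bounds:
  assumes V: "finite V" "odd (card V)" "card V \<ge> 13" and N: "N \<subseteq> nsets V 2"
    and deficient: "\<not> near_perfect V (nsets V 2 - N)"
  shows "card N \<ge> 2 * card V - 3"
    and "disjoint H \<Longrightarrow> H \<subseteq> nsets V 2 \<Longrightarrow> card (N - H) \<ge> 2 * card V - 5"
proof -
  obtain N' M u v w where N': "N' \<subseteq> N"
    and "matched_deficient_graph V (nsets V 2 - N') M u v w"
    using matched_deficient_graph_exists[OF V(1,2) N deficient] .
  then interpret matched_deficient_graph V "nsets V 2 - N'" M u v w by simp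
  have eq: "nsets V 2 - (nsets V 2 - N') = N'" using N N' by blast
  have fin: "finite N" using N finite_edges_total by (rule finite_subset)
  \<comment> \<open>Since n = 2m + 3, this is n >= 13; moreover 4m + 3 = 2n - 3 and 4m + 1 = 2n -
    5.\<close>
  have m: "card M \<ge> 5" using V(3) card_V by linarith
  then have "4 * card M + 3 \<le> card N'" using card_nonedges_ge unfolding eq by linarith
  also have "\<dots> \<le> card N" using fin N' by (rule card_mono)
  finally show "card N \<ge> 2 * card V - 3" using card_V by linarith
  assume "disjoint H" "H \<subseteq> nsets V 2"
  from card_nonedges_diff_matching[OF this m] have "4 * card M + 1 \<le> card (N' - H)"
    unfolding eq .
  also have "\<dots> \<le> card (N - H)" using fin N' by (intro card_mono) auto
  finally show "card (N - H) \<ge> 2 * card V - 5" using card_V by linarith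
qed

text \<open>Apply the bounds to \<open>F\<close> together with the nonedges of G; removing the
  latter again leaves exactly \<open>F\<close>.\<close>

lemma preclusion_set_bounds:
  assumes V: "finite V" "odd (card V)" "card V \<ge> 13" and E: "E \<subseteq> nsets V 2"
    and F: "matching_preclusion_set V E F"
  shows "card F + card (nsets V 2 - E) \<ge> 2 * card V - 3"
    and "disjoint (nsets V 2 - E) \<Longrightarrow> card F \<ge> 2 * card V - 5"
proof -
  let ?H = "nsets V 2 - E"
  have FE: "F \<subseteq> E" using F unfolding matching_preclusion_set_def by blast
  have N: "F \<union> ?H \<subseteq> nsets V 2" using FE E by blast
  have "nsets V 2 - (F \<union> ?H) = E - F" using E by blast
  then have np: "\<not> near_perfect V (nsets V 2 - (F \<union> ?H))"
    using F near_perfect_imp_almost_perfect unfolding matching_preclusion_set_def by metis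
  have "card (F \<union> ?H) \<le> card F + card ?H" by (rule card_Un_le)
  then show "card F + card ?H \<ge> 2 * card V - 3"
    using deficient_nonedges_bounds(1)[OF V N np] by linarith
  assume "disjoint ?H"
  moreover have "F \<union> ?H - ?H = F" using FE by blast
  ultimately show "card F \<ge> 2 * card V - 5"
    using deficient_nonedges_bounds(2)[OF V N np, of ?H] by auto
qed

section \<open>Upper bound by isolating two vertices\<close>

lemma edges_at_two_vertices_preclude:
  assumes "p \<in> V" "q \<in> V" "p \<noteq> q"
  shows "matching_preclusion_set V E {e \<in> E. p \<in> e \<or> q \<in> e}"
  using assms
  unfolding matching_preclusion_set_def perfect_matching_def almost_perfect_matching_def
  by blast

lemma card_edges_at_vertex:
  assumes "finite V" "p \<in> V"
  shows "card {e \<in> nsets V 2. p \<in> e} = card V - 1"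
proof -
  have "{e \<in> nsets V 2. p \<in> e} = (\<lambda>x. {p, x}) ` (V - {p})"
    using assms(2) by (auto elim!: nsets2_E)
  moreover have "inj_on (\<lambda>x. {p, x}) (V - {p})" by (auto simp: inj_on_def doubleton_eq_iff)
  ultimately show ?thesis using assms by (simp add: card_image)
qed

lemma card_edges_at_two_vertices:
  assumes "finite V" "p \<in> V" "q \<in> V" "p \<noteq> q"
  shows "card {e \<in> nsets V 2. p \<in> e \<or> q \<in> e} = 2 * card V - 3"
proof -
  let ?A = "\<lambda>p. {e \<in> nsets V 2. p \<in> e}"
  have fin: "finite (?A p)" for p using finite_imp_finite_nsets[OF assms(1)] by simp
  have "{e \<in> nsets V 2. p \<in> e \<or> q \<in> e} = ?A p \<union> ?A q" by blast
  moreover have "?A p \<inter> ?A q = {{p, q}}" using assms(2-4) by (auto elim!: nsets2_E)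
  then have "card (?A p \<inter> ?A q) = 1" by simp
  ultimately have "card {e \<in> nsets V 2. p \<in> e \<or> q \<in> e} + 1 = card (?A p) + card (?A q)"
    using card_Un_Int[OF fin fin, of p q] by simp
  moreover have "card {p, q} \<le> card V" using assms by (intro card_mono) auto
  ultimately show ?thesis
    using card_edges_at_vertex[OF assms(1,2)] card_edges_at_vertex[OF assms(1,3)] assms(4) by simp
qed

lemma card_split_nonedges:
  assumes "finite V" "E \<subseteq> nsets V 2"
  shows "card {e \<in> E. P e} + card {e \<in> nsets V 2 - E. P e} = card {e \<in> nsets V 2. P e}"
proof -
  have fin: "finite (nsets V 2)" using finite_imp_finite_nsets[OF assms(1)] .
  have "{e \<in> nsets V 2. P e} = {e \<in> E. P e} \<union> {e \<in> nsets V 2 - E. P e}" using assms(2) by blast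
  moreover have "card ({e \<in> E. P e} \<union> {e \<in> nsets V 2 - E. P e})
      = card {e \<in> E. P e} + card {e \<in> nsets V 2 - E. P e}"
    using fin assms(2) by (intro card_Un_disjoint) (auto intro: finite_subset)
  ultimately show ?thesis by simp
qed

lemma mp_upper:
  assumes "finite V" "E \<subseteq> nsets V 2" "p \<in> V" "q \<in> V" "p \<noteq> q"
  shows "mp V E + card {e \<in> nsets V 2 - E. p \<in> e \<or> q \<in> e} \<le> 2 * card V - 3"
proof -
  have "mp V E \<le> card {e \<in> E. p \<in> e \<or> q \<in> e}"
    unfolding mp_def using edges_at_two_vertices_preclude[OF assms(3-5)] by (intro Least_le) blast
  then show ?thesis
    using card_split_nonedges[OF assms(1,2), of "\<lambda>e. p \<in> e \<or> q \<in> e"]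
      card_edges_at_two_vertices[OF assms(1,3-5)] by linarith
qed

text \<open>The \<open>LEAST\<close> in \<open>mp\<close> is meaningful once some preclusion set
  exists, and isolating two vertices provides one.\<close>

lemma mp_attained:
  assumes "card V \<ge> 2"
  obtains F where "matching_preclusion_set V E F" "card F = mp V E"
proof -
  obtain T where "T \<subseteq> V" "card T = 2" using obtain_subset_with_card_n[OF assms] by metis
  then obtain p q where "p \<in> V" "q \<in> V" "p \<noteq> q" by (auto simp: card_2_iff)
  from edges_at_two_vertices_preclude[OF this, of E]
  have "\<exists>k F. matching_preclusion_set V E F \<and> card F = k" by auto
  then have "\<exists>F. matching_preclusion_set V E F \<and> card F = mp V E"
    unfolding mp_def by (rule LeastI_ex)
  then show ?thesis using that by blast
qed

section \<open>Minimum degree in terms of nonedges\<close>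

lemma disjoint_iff_degree_le_1:
  assumes "finite H"
  shows "disjoint H \<longleftrightarrow> (\<forall>v. degree H v \<le> 1)"
proof -
  have eq: "degree H v \<le> 1 \<longleftrightarrow> (\<forall>e\<in>H. \<forall>f\<in>H. v \<in> e \<longrightarrow> v \<in> f \<longrightarrow> e = f)" for v
    unfolding degree_def using card_le_Suc0_iff_eq[of "{e \<in> H. v \<in> e}"] assms by auto
  show ?thesis unfolding eq disjoint_def by blast
qed

lemma degree_nonedges:
  assumes "finite V" "E \<subseteq> nsets V 2" "v \<in> V"
  shows "degree E v + degree (nsets V 2 - E) v = card V - 1"
  using card_split_nonedges[OF assms(1,2), of "\<lambda>e. v \<in> e"] card_edges_at_vertex[OF assms(1,3)]
  unfolding degree_def by simp

text \<open>Degrees in the graph and its complement add up to n - 1, so minimum degree n - 2 means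
  that the complement has maximum degree exactly 1.\<close>

lemma min_degree_eq_iff_nonedges_matching:
  assumes V: "finite V" "card V \<ge> 2" and E: "E \<subseteq> nsets V 2"
  shows "min_degree V E = card V - 2 \<longleftrightarrow> disjoint (nsets V 2 - E) \<and> nsets V 2 - E \<noteq> {}"
proof -
  let ?H = "nsets V 2 - E"
  have fin: "finite ?H" using finite_imp_finite_nsets[OF V(1)] by simp
  have ne: "V \<noteq> {}" using V(2) by auto
  have deg: "degree E v + degree ?H v = card V - 1" if "v \<in> V" for v
    using degree_nonedges[OF V(1) E that] .
  show ?thesis
  proof
    assume m: "min_degree V E = card V - 2"
    have "degree ?H v \<le> 1" for v
    proof (cases "v \<in> V")
      case True
      have "min_degree V E \<le> degree E v" unfolding min_degree_def using V(1) True by simp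
      then show ?thesis using m deg[OF True] by linarith
    next
      case False
      then have "{e \<in> ?H. v \<in> e} = {}" by (auto simp: nsets_def)
      then show ?thesis unfolding degree_def by (metis card.empty zero_le)
    qed
    then have "disjoint ?H" using disjoint_iff_degree_le_1[OF fin] by blast
    moreover have "?H \<noteq> {}"
    proof
      assume H: "?H = {}"
      have "min_degree V E \<in> degree E ` V" unfolding min_degree_def using V(1) ne by (intro Min_in) auto
      then obtain v where v: "v \<in> V" "degree E v = card V - 2" using m by auto
      have "degree ?H v = 0" unfolding H degree_def by simp
      then show False using deg[OF v(1)] v(2) V(2) by linarith
    qed
    ultimately show "disjoint ?H \<and> ?H \<noteq> {}" by blast
  next
    assume H: "disjoint ?H \<and> ?H \<noteq> {}"
    then have le: "degree ?H v \<le> 1" for v using disjoint_iff_degree_le_1[OF fin] by blast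
    obtain e where e: "e \<in> ?H" using H by blast
    then obtain v where v: "v \<in> V" "v \<in> e" by (auto elim!: nsets2_E)
    have "{e} \<subseteq> {e \<in> ?H. v \<in> e}" using e v by blast
    then have "card {e} \<le> degree ?H v" unfolding degree_def by (intro card_mono finite_subset[OF _ fin]) auto
    then have "degree E v = card V - 2" using deg[OF v(1)] le[of v] by simp
    moreover have "card V - 2 \<le> degree E x" if "x \<in> V" for x using deg[OF that] le[of x] by linarith
    ultimately show "min_degree V E = card V - 2"
      unfolding min_degree_def using V(1) v(1) by (intro Min_eqI) (auto intro: rev_image_eqI)
  qed
qed

section \<open>The characterization\<close>

theorem theorem3p9:
  fixes V :: "'a set" and E :: "'a set set" and n :: nat
  assumes "finite_simple_graph V E"
    and "card V = n"
    and "odd n"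
    and "n \<ge> 13"
  shows "mp V E = 2 * n - 5 \<longleftrightarrow>
    (min_degree V E = n - 2 \<and> \<not> is_complete_minus_edge V E) \<or>
    is_complete_minus_P3 V E"
proof -
  let ?K = "nsets V 2" and ?H = "nsets V 2 - E"
  have V: "finite V" "odd (card V)" "card V \<ge> 13" and E: "E \<subseteq> ?K"
    using assms unfolding finite_simple_graph_def complete_edges_def by auto
  have V2: "card V \<ge> 2" using V(3) by linarith
  have fin: "finite ?H" using finite_imp_finite_nsets[OF V(1)] by simp
  obtain F where F: "matching_preclusion_set V E F" "card F = mp V E"
    using mp_attained[OF V2] .
  have lower: "mp V E + card ?H \<ge> 2 * n - 3" "disjoint ?H \<Longrightarrow> mp V E \<ge> 2 * n - 5"
    using preclusion_set_bounds[OF V E F(1)] F(2) assms(2) by auto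
  \<comment> \<open>Isolating \<open>p\<close> and \<open>q\<close> costs 2n - 3 minus the nonedges
    met, and both \<open>e\<close> and \<open>f\<close> are met.\<close>
  have upper: "mp V E \<le> 2 * n - 5" if H: "e \<in> ?H" "f \<in> ?H" "e \<noteq> f"
    and pq: "p \<in> e" "q \<in> f" "p \<noteq> q" for e f p q
  proof -
    have "p \<in> V" "q \<in> V" using H(1,2) pq by (auto simp: nsets_def)
    then have "mp V E + card {e \<in> ?H. p \<in> e \<or> q \<in> e} \<le> 2 * n - 3"
      using mp_upper[OF V(1) E] pq(3) assms(2) by blast
    moreover have "card {e, f} \<le> card {e \<in> ?H. p \<in> e \<or> q \<in> e}"
      using H pq by (intro card_mono finite_subset[OF _ fin]) auto
    ultimately show ?thesis using H(3) by simp
  qed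
  have minus_edge: "is_complete_minus_edge V E \<longleftrightarrow> (\<exists>e. ?H = {e})"
  proof
    assume "is_complete_minus_edge V E"
    then obtain e where "e \<in> ?K" "E = ?K - {e}"
      unfolding is_complete_minus_edge_def complete_edges_def by blast
    then show "\<exists>e. ?H = {e}" by auto
  next
    assume "\<exists>e. ?H = {e}"
    then obtain e where e: "?H = {e}" by blast
    then have "e \<in> ?K" by blast
    moreover have "E = ?K - {e}" unfolding e[symmetric] using E by blast
    ultimately show "is_complete_minus_edge V E"
      unfolding is_complete_minus_edge_def complete_edges_def by blast
  qed
  have min_deg: "min_degree V E = n - 2 \<longleftrightarrow> disjoint ?H \<and> ?H \<noteq> {}"
    using min_degree_eq_iff_nonedges_matching[OF V(1) V2 E] assms(2) by simp
  show ?thesis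
  proof
    assume mp: "mp V E = 2 * n - 5"
    have H2: "card ?H \<ge> 2" using lower(1) mp assms(4) by linarith
    show "(min_degree V E = n - 2 \<and> \<not> is_complete_minus_edge V E) \<or> is_complete_minus_P3 V E"
    proof (cases "disjoint ?H")
      case True
      have "?H \<noteq> {}"
      proof
        assume "?H = {}"
        then have "card ?H = 0" by (simp only: card.empty)
        then show False using H2 by simp
      qed
      moreover have "?H \<noteq> {e}" for e
      proof
        assume "?H = {e}"
        then have "card ?H = 1" by simp
        then show False using H2 by simp
      qed
      ultimately show ?thesis using True min_deg minus_edge by blast
    next
      case False
      then obtain e f y where ef: "e \<in> ?H" "f \<in> ?H" "e \<noteq> f" "y \<in> e" "y \<in> f"
        unfolding disjoint_def by blast
      obtain x where x: "e = {x, y}" "x \<in> V" "y \<in> V" "x \<noteq> y"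
        using ef(1,4) by (auto elim!: nsets2_E)
      obtain z where z: "f = {y, z}" "z \<in> V" "y \<noteq> z"
        using ef(2,5) by (auto elim!: nsets2_E)
      \<comment> \<open>Given a third nonedge \<open>g\<close>, isolating \<open>y\<close> and
        another vertex of \<open>g\<close> would save three deletions, so \<open>mp\<close> would be
        at most 2n - 6.\<close>
      have "?H \<subseteq> {e, f}"
      proof
        fix g assume g: "g \<in> ?H"
        show "g \<in> {e, f}"
        proof (rule ccontr)
          assume g': "g \<notin> {e, f}"
          obtain p where p: "p \<in> g" "p \<noteq> y" "p \<in> V" using g by (auto elim!: nsets2_E)
          have "mp V E + card {e \<in> ?H. y \<in> e \<or> p \<in> e} \<le> 2 * n - 3"
            using mp_upper[OF V(1) E x(3) p(3)] p(2) assms(2) by simp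
          moreover have "card {e, f, g} \<le> card {e \<in> ?H. y \<in> e \<or> p \<in> e}"
            using ef g p by (intro card_mono finite_subset[OF _ fin]) auto
          moreover have "card {e, f, g} = 3" using g' ef(3) by (simp add: eq_commute[of g])
          ultimately show False using mp assms(4) by linarith
        qed
      qed
      then have "?H = {e, f}" using ef by blast
      then have "?K - {e, f} = E" using E by (metis double_diff order_refl)
      then have "E = ?K - {{x, y}, {y, z}}" unfolding x(1) z(1) ..
      moreover have "x \<noteq> z" using x(1) z(1) ef(3) by auto
      ultimately have "is_complete_minus_P3 V E"
        unfolding is_complete_minus_P3_def complete_edges_def using x z by blast
      then show ?thesis ..
    qed
  next
    assume "(min_degree V E = n - 2 \<and> \<not> is_complete_minus_edge V E) \<or> is_complete_minus_P3 V E"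
    then show "mp V E = 2 * n - 5"
    proof
      assume "min_degree V E = n - 2 \<and> \<not> is_complete_minus_edge V E"
      then have H: "disjoint ?H" "?H \<noteq> {}" "\<nexists>e. ?H = {e}" using min_deg minus_edge by blast+
      then obtain e f where ef: "e \<in> ?H" "f \<in> ?H" "e \<noteq> f" by blast
      have "e \<noteq> {}" "f \<noteq> {}" using ef by (auto simp: nsets_def)
      then obtain p q where "p \<in> e" "q \<in> f" by blast
      moreover have "p \<noteq> q" using disjointD[OF H(1) ef] calculation by blast
      ultimately show ?thesis using upper[OF ef] lower(2)[OF H(1)] by (simp add: le_antisym)
    next
      assume "is_complete_minus_P3 V E"
      then obtain x y z where xyz: "x \<in> V" "y \<in> V" "z \<in> V" "x \<noteq> y" "y \<noteq> z" "x \<noteq> z"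
        "E = ?K - {{x, y}, {y, z}}"
        unfolding is_complete_minus_P3_def complete_edges_def by blast
      then have H: "?H = {{x, y}, {y, z}}" by auto
      have ne: "{x, y} \<noteq> {y, z}" using xyz(4-6) by (auto simp: doubleton_eq_iff)
      then have "card ?H = 2" unfolding H by simp
      \<comment> \<open>The two nonedges share \<open>y\<close>, so the bound for matchings does not
        apply; the general bound 2n - 3 minus two nonedges is already sharp.\<close>
      then have "mp V E \<ge> 2 * n - 5" using lower(1) by linarith
      moreover have "mp V E \<le> 2 * n - 5"
        using upper[of "{x, y}" "{y, z}" x y] ne xyz(4) unfolding H by simp
      ultimately show ?thesis by simp
    qed
  qed
qed

end
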